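(* Let $d\ge1$, $N\ge 2$, let $\{|x\rangle\}_{x=0}^{d-1}$ be an orthonormal basis of $\mathbb{C}^d$, $\Pi_x=|x\rangle\langle x|$, let $\rho_{t_1}$ be a density matrix on $\mathbb{C}^d$ and ${\cal N}_{t_i\to t_{i+1}}$ ($1\le i\le N-1$) quantum channels on $\mathbb{C}^d$. Then the $N$-time quasi-probability distribution satisfies, for every $k\in\{1,\dots,N\}$ and all values of the remaining variables, $$\sum_{x_k}p(x_1,\dots,x_N)=p(x_1,\dots,x_{k-1},x_{k+1},\dots,x_N),$$ where the right-hand side is the quasi-probability distribution for the time sequence with $t_k$ omitted. In particular, for each $i$, the marginal of $p(x_1,\dots,x_N)$ at the single time $t_i$ is real and non-negative and equals $\mathrm{Tr}[\rho_{t_i}\Pi_{x_i}]$.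
   Context: A quantum channel is a completely positive trace-preserving linear map on operators on $\mathbb{C}^d$. For $i<j$, ${\cal N}_{t_i\to t_j}={\cal N}_{t_{j-1}\to t_j}\circ\cdots\circ{\cal N}_{t_i\to t_{i+1}}$, and $\rho_{t_j}={\cal N}_{t_1\to t_j}(\rho_{t_1})$. Define the linear map ${\cal M}_x(\rho)=\rho\,\Pi_x$. For a time subsequence $t_{i_1},\dots,t_{i_r}$ with $1\le i_1<\cdots<i_r\le N$, the associated quasi-probability distribution is $$p(x_{i_1},\dots,x_{i_r})=\mathrm{Tr}\big[({\cal M}_{x_{i_r}}\circ{\cal N}_{t_{i_{r-1}}\to t_{i_r}}\circ\cdots\circ{\cal M}_{x_{i_2}}\circ{\cal N}_{t_{i_1}\to t_{i_2}}\circ{\cal M}_{x_{i_1}})(\rho_{t_{i_1}})\big];$$ the $N$-time quasi-probability distribution $p(x_1,\dots,x_N)$ is the case of the full sequence $t_1,\dots,t_N$. Sums over $x_k$ run over $\{0,\dots,d-1\}$. *)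

theory Defs
  imports
    "Jordan_Normal_Form.Matrix"
    "Jordan_Normal_Form.VS_Connect"
    "HOL-Library.FuncSet"
begin

(* Operators on C^d are the elements of carrier_mat d d; behaviour of maps outside this
   carrier is irrelevant.  The form v \<bullet>c w is linear in v and conjugate-linear in w, so
   <w|v> is rendered as v \<bullet>c w. *)

(* The order on complex is that of Complex_Order: 0 \<le> z means that z is real and
   non-negative.  Over the complex numbers this forces A to be Hermitian. *)
definition pos_semidef :: "nat \<Rightarrow> complex mat \<Rightarrow> bool" where
  "pos_semidef n A \<longleftrightarrow>
     A \<in> carrier_mat n n \<and> (\<forall>v\<in>carrier_vec n. 0 \<le> (A *\<^sub>v v) \<bullet>c v)"

definition mat_trace :: "complex mat \<Rightarrow> complex" where
  "mat_trace A = (\<Sum>i<dim_row A. A $$ (i, i))"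

definition density_matrix :: "nat \<Rightarrow> complex mat \<Rightarrow> bool" where
  "density_matrix d \<rho> \<longleftrightarrow> pos_semidef d \<rho> \<and> mat_trace \<rho> = 1"

definition linear_map :: "nat \<Rightarrow> (complex mat \<Rightarrow> complex mat) \<Rightarrow> bool" where
  "linear_map d \<Phi> \<longleftrightarrow>
     (\<forall>A\<in>carrier_mat d d. \<Phi> A \<in> carrier_mat d d) \<and>
     (\<forall>A\<in>carrier_mat d d. \<forall>B\<in>carrier_mat d d. \<Phi> (A + B) = \<Phi> A + \<Phi> B) \<and>
     (\<forall>c. \<forall>A\<in>carrier_mat d d. \<Phi> (c \<cdot>\<^sub>m A) = c \<cdot>\<^sub>m \<Phi> A)"

(* mat_block d X a b is the (a,b) block, of size d x d, of the block matrix X. *)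
definition mat_block :: "nat \<Rightarrow> complex mat \<Rightarrow> nat \<Rightarrow> nat \<Rightarrow> complex mat" where
  "mat_block d X a b = mat d d (\<lambda>(i, j). X $$ (a * d + i, b * d + j))"

(* The map id_n \<otimes> \<Phi> on operators on C^n \<otimes> C^d, where e_a \<otimes> e_i is the standard
   basis vector number a * d + i: it applies \<Phi> to each d x d block. *)
definition ampliation ::
  "nat \<Rightarrow> nat \<Rightarrow> (complex mat \<Rightarrow> complex mat) \<Rightarrow> complex mat \<Rightarrow> complex mat" where
  "ampliation n d \<Phi> X =
     mat (n * d) (n * d) (\<lambda>(r, s). \<Phi> (mat_block d X (r div d) (s div d)) $$ (r mod d, s mod d))"

definition completely_positive :: "nat \<Rightarrow> (complex mat \<Rightarrow> complex mat) \<Rightarrow> bool" where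
  "completely_positive d \<Phi> \<longleftrightarrow>
     (\<forall>n X. pos_semidef (n * d) X \<longrightarrow> pos_semidef (n * d) (ampliation n d \<Phi> X))"

definition trace_preserving :: "nat \<Rightarrow> (complex mat \<Rightarrow> complex mat) \<Rightarrow> bool" where
  "trace_preserving d \<Phi> \<longleftrightarrow> (\<forall>A\<in>carrier_mat d d. mat_trace (\<Phi> A) = mat_trace A)"

definition quantum_channel :: "nat \<Rightarrow> (complex mat \<Rightarrow> complex mat) \<Rightarrow> bool" where
  "quantum_channel d \<Phi> \<longleftrightarrow>
     linear_map d \<Phi> \<and> completely_positive d \<Phi> \<and> trace_preserving d \<Phi>"

definition orthonormal_basis :: "nat \<Rightarrow> (nat \<Rightarrow> complex vec) \<Rightarrow> bool" where
  "orthonormal_basis d ket \<longleftrightarrow>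
     vectorspace.basis class_ring (module_vec TYPE(complex) d) (ket ` {..<d}) \<and>
     (\<forall>x<d. \<forall>y<d. ket x \<bullet>c ket y = (if x = y then 1 else 0))"

definition basis_proj :: "nat \<Rightarrow> (nat \<Rightarrow> complex vec) \<Rightarrow> nat \<Rightarrow> complex mat" where
  "basis_proj d ket x = mat d d (\<lambda>(i, j). ket x $ i * cnj (ket x $ j))"

definition meas_map ::
  "nat \<Rightarrow> (nat \<Rightarrow> complex vec) \<Rightarrow> nat \<Rightarrow> complex mat \<Rightarrow> complex mat" where
  "meas_map d ket x \<rho> = \<rho> * basis_proj d ket x"

(* Chan i is the channel from time t_i to t_{i+1}; evolve Chan i j is the channel from t_i to
   t_j (i \<le> j), the identity for i = j. *)
definition evolve ::
  "(nat \<Rightarrow> complex mat \<Rightarrow> complex mat) \<Rightarrow> nat \<Rightarrow> nat \<Rightarrow> complex mat \<Rightarrow> complex mat" where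
  "evolve Chan i j = fold Chan [i..<j]"

definition state_at ::
  "(nat \<Rightarrow> complex mat \<Rightarrow> complex mat) \<Rightarrow> complex mat \<Rightarrow> nat \<Rightarrow> complex mat" where
  "state_at Chan \<rho>1 j = evolve Chan 1 j \<rho>1"

(* meas_chain d ket Chan x i ts A: starting from the operator A at time t_i, alternately evolve
   to the next time in ts and apply the measurement map there. *)
primrec meas_chain ::
  "nat \<Rightarrow> (nat \<Rightarrow> complex vec) \<Rightarrow> (nat \<Rightarrow> complex mat \<Rightarrow> complex mat) \<Rightarrow> (nat \<Rightarrow> nat) \<Rightarrow>
   nat \<Rightarrow> nat list \<Rightarrow> complex mat \<Rightarrow> complex mat" where
  "meas_chain d ket Chan x i [] A = A"
| "meas_chain d ket Chan x i (j # ts) A =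
     meas_chain d ket Chan x j ts (meas_map d ket (x j) (evolve Chan i j A))"

(* The quasi-probability p(x_{i_1}, ..., x_{i_r}) for the time subsequence given by the
   non-empty strictly increasing list ts = [i_1, ..., i_r] of time indices.  The outcomes are
   passed as an assignment x from time indices to outcomes; only its values on ts matter. *)
definition quasi_prob ::
  "nat \<Rightarrow> (nat \<Rightarrow> complex vec) \<Rightarrow> (nat \<Rightarrow> complex mat \<Rightarrow> complex mat) \<Rightarrow> complex mat \<Rightarrow>
   nat list \<Rightarrow> (nat \<Rightarrow> nat) \<Rightarrow> complex" where
  "quasi_prob d ket Chan \<rho>1 ts x =
     mat_trace (meas_chain d ket Chan x (hd ts) (tl ts)
       (meas_map d ket (x (hd ts)) (state_at Chan \<rho>1 (hd ts))))"

(* The marginal of the N-time quasi-probability distribution at the single time t_i, at the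
   value y: the sum over all values of the variables x_j with j \<noteq> i. *)
definition marginal_at ::
  "nat \<Rightarrow> (nat \<Rightarrow> complex vec) \<Rightarrow> (nat \<Rightarrow> complex mat \<Rightarrow> complex mat) \<Rightarrow> complex mat \<Rightarrow>
   nat \<Rightarrow> nat \<Rightarrow> nat \<Rightarrow> complex" where
  "marginal_at d ket Chan \<rho>1 N i y =
     (\<Sum>x \<in> ({1..N} - {i}) \<rightarrow>\<^sub>E {..<d}. quasi_prob d ket Chan \<rho>1 [1..<Suc N] (x(i := y)))"

end

theory Submission
  imports Defs
begin

(* Idea: Orthonormality gives completeness, sum_y Pi_y = 1, so summing the linear map
   A |-> A Pi_y over y gives the identity.  Summing over the outcome at time t_k
   therefore deletes the measurement at t_k; by linearity the sum may be pulled through the later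
   maps, and the two adjacent evolutions merge.  If t_k is the last time, the leftover evolution
   disappears under the trace.  Deleting all measurements but one leaves Tr(rho Pi) = <x|rho|x>,
   which is non-negative because channels are positive. *)

section \<open>Completeness of the projectors and finite sums of operators\<close>

lemma orthonormal_basis_carrier:
  assumes "orthonormal_basis d ket" and "x < d"
  shows "ket x \<in> carrier_vec d"
proof -
  interpret vec_space "TYPE(complex)" d .
  have "basis (ket ` {..<d})"
    using assms(1) unfolding orthonormal_basis_def by simp
  then show ?thesis
    using assms(2) unfolding basis_def by auto
qed

lemma basis_proj_carrier [simp]: "basis_proj d ket x \<in> carrier_mat d d"
  by (simp add: basis_proj_def)

text \<open>Let \<open>U\<close> have the kets as columns and let \<open>V\<close> be its adjoint.
  Orthonormality says \<open>V * U = 1\<close>; for square matrices a left inverse is also a right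
  inverse, and \<open>U * V\<close> is the sum of the projectors.\<close>

lemma basis_proj_complete:
  assumes onb: "orthonormal_basis d ket" and i: "i < d" and j: "j < d"
  shows "(\<Sum>x<d. basis_proj d ket x $$ (i, j)) = (if i = j then 1 else 0)"
proof -
  define U where "U = mat d d (\<lambda>(i, x). ket x $ i)"
  define V where "V = mat d d (\<lambda>(x, i). cnj (ket x $ i))"
  have "V * U = 1\<^sub>m d"
  proof (rule eq_matI)
    fix x y assume xy: "x < dim_row (1\<^sub>m d)" "y < dim_col (1\<^sub>m d)"
    have "(V * U) $$ (x, y) = ket y \<bullet>c ket x"
      using xy orthonormal_basis_carrier[OF onb, of x] orthonormal_basis_carrier[OF onb, of y]
      by (auto simp: U_def V_def scalar_prod_def intro!: sum.cong)
    then show "(V * U) $$ (x, y) = 1\<^sub>m d $$ (x, y)"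
      using onb xy unfolding orthonormal_basis_def by auto
  qed (auto simp: U_def V_def)
  then have "U * V = 1\<^sub>m d"
    by (rule mat_mult_left_right_inverse[rotated 2]) (auto simp: U_def V_def)
  then have "(U * V) $$ (i, j) = (if i = j then 1 else 0)"
    using i j by simp
  moreover have "(U * V) $$ (i, j) = (\<Sum>x<d. basis_proj d ket x $$ (i, j))"
    using i j by (auto simp: U_def V_def basis_proj_def scalar_prod_def atLeast0LessThan)
  ultimately show ?thesis by simp
qed

lemma meas_map_carrier [simp]:
  "A \<in> carrier_mat d d \<Longrightarrow> meas_map d ket x A \<in> carrier_mat d d"
  unfolding meas_map_def by (rule mult_carrier_mat) auto

lemma meas_map_add:
  assumes "A \<in> carrier_mat d d" "B \<in> carrier_mat d d"
  shows "meas_map d ket x (A + B) = meas_map d ket x A + meas_map d ket x B"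
  unfolding meas_map_def using assms by (rule add_mult_distrib_mat[OF _ _ basis_proj_carrier])

text \<open>Completeness makes the sum of the maps A |-> A Pi_y the identity. The sum of operators
  is formed entrywise, because matrices of all sizes share one type and have no common zero.\<close>

lemma sum_meas_map:
  assumes onb: "orthonormal_basis d ket" and A: "A \<in> carrier_mat d d"
  shows "mat d d (\<lambda>ij. \<Sum>y<d. meas_map d ket y A $$ ij) = A"
proof (rule eq_matI)
  fix i j assume "i < dim_row A" "j < dim_col A"
  with A have ij: "i < d" "j < d" by auto
  have "(\<Sum>y<d. meas_map d ket y A $$ (i, j))
      = (\<Sum>y<d. \<Sum>l<d. A $$ (i, l) * basis_proj d ket y $$ (l, j))"
    using A ij by (auto simp: meas_map_def scalar_prod_def basis_proj_def atLeast0LessThan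
        intro!: sum.cong)
  also have "\<dots> = (\<Sum>l<d. A $$ (i, l) * (\<Sum>y<d. basis_proj d ket y $$ (l, j)))"
    by (subst sum.swap) (simp add: sum_distrib_left)
  also have "\<dots> = (\<Sum>l<d. A $$ (i, l) * (if l = j then 1 else 0))"
    using basis_proj_complete[OF onb] ij by (intro sum.cong) auto
  also have "\<dots> = A $$ (i, j)"
    using ij by (simp add: if_distrib[of "(*) _"] cong: if_cong)
  finally show "mat d d (\<lambda>ij. \<Sum>y<d. meas_map d ket y A $$ ij) $$ (i, j) = A $$ (i, j)"
    using ij by simp
qed (use A in auto)

text \<open>Will be applied with \<open>F\<close> the trace of the rest of a chain, to move the sum
  over an outcome inside.\<close>

lemma additive_functional_sum:
  fixes F :: "complex mat \<Rightarrow> complex" and n :: nat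
  assumes add: "\<And>A B. A \<in> carrier_mat d d \<Longrightarrow> B \<in> carrier_mat d d \<Longrightarrow> F (A + B) = F A + F B"
    and B: "\<And>y. B y \<in> carrier_mat d d"
  shows "F (mat d d (\<lambda>ij. \<Sum>y<n. B y $$ ij)) = (\<Sum>y<n. F (B y))"
proof (induction n)
  case 0
  \<comment> \<open>The empty sum requires \<open>F\<close> to vanish at zero; this follows from
    F(0) = F(0) + F(0).\<close>
  have "0\<^sub>m d d + 0\<^sub>m d d = (0\<^sub>m d d :: complex mat)" by simp
  with add[of "0\<^sub>m d d" "0\<^sub>m d d"] have "F (0\<^sub>m d d) = 0" by simp
  moreover have "mat d d (\<lambda>ij. \<Sum>y<0. B y $$ ij) = 0\<^sub>m d d" by (intro eq_matI) auto
  ultimately show ?case by simp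
next
  case (Suc n)
  have "mat d d (\<lambda>ij. \<Sum>y<Suc n. B y $$ ij) = mat d d (\<lambda>ij. \<Sum>y<n. B y $$ ij) + B n"
    using B[of n] by (intro eq_matI) auto
  with Suc add[OF _ B] show ?case by simp
qed

section \<open>Trace and positivity\<close>

lemma mat_trace_add:
  assumes "A \<in> carrier_mat d d" "B \<in> carrier_mat d d"
  shows "mat_trace (A + B) = mat_trace A + mat_trace B"
  using assms by (simp add: mat_trace_def sum.distrib)

text \<open>For n = 1 there is a single block, so the ampliation is the map itself.\<close>

lemma completely_positive_imp_positive:
  assumes "completely_positive d \<Phi>" "linear_map d \<Phi>" "pos_semidef d A"
  shows "pos_semidef d (\<Phi> A)"
proof -
  have A: "A \<in> carrier_mat d d" using assms(3) by (simp add: pos_semidef_def)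
  then have "mat_block d A 0 0 = A"
    by (intro eq_matI) (auto simp: mat_block_def)
  moreover have "\<Phi> A \<in> carrier_mat d d" using assms(2) A by (simp add: linear_map_def)
  ultimately have "ampliation 1 d \<Phi> A = \<Phi> A"
    by (intro eq_matI) (auto simp: ampliation_def)
  moreover have "pos_semidef d (ampliation 1 d \<Phi> A)"
    using assms(1,3) unfolding completely_positive_def by (metis mult_1)
  ultimately show ?thesis by simp
qed

text \<open>Turns Tr(A Pi_x) into the quadratic form <x|A|x>, in terms of which positivity is
  defined.\<close>

lemma mat_trace_mult_basis_proj:
  assumes "A \<in> carrier_mat d d" "ket x \<in> carrier_vec d"
  shows "mat_trace (A * basis_proj d ket x) = (A *\<^sub>v ket x) \<bullet>c ket x"
proof -
  have "mat_trace (A * basis_proj d ket x)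
      = (\<Sum>i<d. \<Sum>l<d. A $$ (i, l) * (ket x $ l * cnj (ket x $ i)))"
    using assms by (auto simp: mat_trace_def basis_proj_def scalar_prod_def atLeast0LessThan
        intro!: sum.cong)
  also have "\<dots> = (A *\<^sub>v ket x) \<bullet>c ket x"
    using assms by (auto simp: scalar_prod_def sum_distrib_right atLeast0LessThan mult.assoc
        intro!: sum.cong)
  finally show ?thesis .
qed

section \<open>Composition of evolutions and dependence of chains on the outcomes\<close>

lemma evolve_Suc: "i \<le> j \<Longrightarrow> evolve Chan i (Suc j) A = Chan j (evolve Chan i j A)"
  by (simp add: evolve_def)

lemma evolve_trans:
  assumes "i \<le> j" "j \<le> k"
  shows "evolve Chan j k (evolve Chan i j A) = evolve Chan i k A"
proof -
  have "[i..<k] = [i..<j] @ [j..<k]"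
    using upt_add_eq_append[OF assms(1), of "k - j"] assms(2) by simp
  then show ?thesis by (simp add: evolve_def)
qed

(* The initial evolution of quasi_prob is absorbed as the first step of the chain. *)
lemma quasi_prob_conv_meas_chain:
  "ts \<noteq> [] \<Longrightarrow> quasi_prob d ket Chan \<rho> ts x = mat_trace (meas_chain d ket Chan x 1 ts \<rho>)"
  by (cases ts) (simp_all add: quasi_prob_def state_at_def)

lemma meas_chain_cong:
  "(\<And>j. j \<in> set ts \<Longrightarrow> x j = y j) \<Longrightarrow> meas_chain d ket Chan x i ts A = meas_chain d ket Chan y i ts A"
  by (induction ts arbitrary: i A) auto

section \<open>Evolution under quantum channels\<close>

locale channel_sequence =
  fixes d N :: nat and Chan :: "nat \<Rightarrow> complex mat \<Rightarrow> complex mat"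
  assumes channel: "1 \<le> i \<Longrightarrow> i < N \<Longrightarrow> quantum_channel d (Chan i)"
begin

lemma channel_linear: "1 \<le> i \<Longrightarrow> i < N \<Longrightarrow> linear_map d (Chan i)"
  using channel by (simp add: quantum_channel_def)

text \<open>An invariance principle: it will give closure of the carrier, preservation of the trace
  and positivity.\<close>

lemma evolve_closed:
  assumes step: "\<And>n B. 1 \<le> n \<Longrightarrow> n < N \<Longrightarrow> P B \<Longrightarrow> P (Chan n B)"
    and "P A" "1 \<le> i" "j \<le> N"
  shows "P (evolve Chan i j A)"
  using \<open>j \<le> N\<close>
proof (induction j)
  case 0
  then show ?case using \<open>P A\<close> by (simp add: evolve_def)
next
  case (Suc j)
  show ?case
  proof (cases "i \<le> j")
    case True
    then show ?thesis using Suc step \<open>1 \<le> i\<close> by (simp add: evolve_Suc)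
  next
    case False
    \<comment> \<open>Here \<open>[i..<Suc j]\<close> is empty, so the evolution is the
      identity.\<close>
    then show ?thesis using \<open>P A\<close> by (simp add: evolve_def)
  qed
qed

lemma evolve_carrier:
  assumes "A \<in> carrier_mat d d" "1 \<le> i" "j \<le> N"
  shows "evolve Chan i j A \<in> carrier_mat d d"
  by (rule evolve_closed[where P = "\<lambda>B. B \<in> carrier_mat d d", OF _ assms])
    (use channel_linear in \<open>auto simp: linear_map_def\<close>)

lemma evolve_trace:
  assumes "A \<in> carrier_mat d d" "1 \<le> i" "j \<le> N"
  shows "mat_trace (evolve Chan i j A) = mat_trace A"
proof -
  \<comment> \<open>Channels are trace preserving only on the carrier, so membership is carried
    along in the invariant.\<close>
  have "evolve Chan i j A \<in> carrier_mat d d \<and> mat_trace (evolve Chan i j A) = mat_trace A"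
  proof (rule evolve_closed)
    fix n B
    assume "1 \<le> n" "n < N" and B: "B \<in> carrier_mat d d \<and> mat_trace B = mat_trace A"
    then have "quantum_channel d (Chan n)" using channel by simp
    with B show "Chan n B \<in> carrier_mat d d \<and> mat_trace (Chan n B) = mat_trace A"
      by (auto simp: quantum_channel_def linear_map_def trace_preserving_def)
  qed (use assms in auto)
  then show ?thesis by simp
qed

lemma evolve_pos_semidef:
  assumes "pos_semidef d A" "1 \<le> i" "j \<le> N"
  shows "pos_semidef d (evolve Chan i j A)"
  by (rule evolve_closed[where P = "pos_semidef d", OF _ assms])
    (use channel completely_positive_imp_positive in \<open>auto simp: quantum_channel_def\<close>)

lemma evolve_add:
  assumes "A \<in> carrier_mat d d" "B \<in> carrier_mat d d" "1 \<le> i" "j \<le> N"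
  shows "evolve Chan i j (A + B) = evolve Chan i j A + evolve Chan i j B"
  using \<open>j \<le> N\<close>
proof (induction j)
  case 0
  then show ?case by (simp add: evolve_def)
next
  case (Suc j)
  show ?case
  proof (cases "i \<le> j")
    case True
    then have "linear_map d (Chan j)" using channel_linear Suc assms(3) by simp
    moreover have "evolve Chan i j A \<in> carrier_mat d d" "evolve Chan i j B \<in> carrier_mat d d"
      using evolve_carrier assms Suc by simp_all
    ultimately show ?thesis using Suc True by (simp add: evolve_Suc linear_map_def)
  next
    case False
    then show ?thesis by (simp add: evolve_def)
  qed
qed

section \<open>Summing out the outcomes at one or several times\<close>

lemma trace_meas_chain_add:
  assumes "A \<in> carrier_mat d d" "B \<in> carrier_mat d d" "1 \<le> i" "set ts \<subseteq> {1..N}"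
  shows "mat_trace (meas_chain d ket Chan x i ts (A + B))
       = mat_trace (meas_chain d ket Chan x i ts A) + mat_trace (meas_chain d ket Chan x i ts B)"
  using assms
proof (induction ts arbitrary: i A B)
  case Nil
  then show ?case by (simp add: mat_trace_add)
next
  case (Cons j ts)
  then show ?case by (simp add: evolve_add meas_map_add evolve_carrier)
qed

text \<open>The induction walks along the times until it meets \<open>k\<close>, so the start time
  and the operator must be arbitrary. Allowing the first time to equal \<open>i\<close> covers a
  measurement at the start, where the evolution is the identity.\<close>

lemma sum_trace_meas_chain:
  assumes onb: "orthonormal_basis d ket"
    and "A \<in> carrier_mat d d" "1 \<le> i" "set ts \<subseteq> {1..N}"
    and "sorted_wrt (<) ts" "\<forall>j\<in>set ts. i \<le> j" "k \<in> set ts"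
  shows "(\<Sum>y<d. mat_trace (meas_chain d ket Chan (x(k := y)) i ts A))
       = mat_trace (meas_chain d ket Chan x i (filter (\<lambda>j. j \<noteq> k) ts) A)"
  using assms(2-)
proof (induction ts arbitrary: i A)
  case Nil
  then show ?case by simp
next
  case (Cons j ts)
  define E where "E = evolve Chan i j A"
  have E: "E \<in> carrier_mat d d"
    using Cons.prems by (auto simp: E_def intro!: evolve_carrier)
  have j: "1 \<le> j" "j \<le> N" "i \<le> j" and ts: "set ts \<subseteq> {1..N}" "\<forall>l\<in>set ts. j < l" "sorted_wrt (<) ts"
    using Cons.prems by auto
  show ?case
  proof (cases "j = k")
    case False
    with Cons.prems have "k \<in> set ts" by simp
    \<comment> \<open>The measurement at \<open>j\<close> does not see the update at
      \<open>k\<close>, so the induction hypothesis applies from time \<open>j\<close> on.\<close>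
    then have "(\<Sum>y<d. mat_trace (meas_chain d ket Chan (x(k := y)) j ts (meas_map d ket (x j) E)))
       = mat_trace (meas_chain d ket Chan x j (filter (\<lambda>l. l \<noteq> k) ts) (meas_map d ket (x j) E))"
      using E j ts by (intro Cons.IH) (auto simp: less_imp_le)
    with False show ?thesis by (simp add: E_def fun_upd_def)
  next
    case True
    have k: "k \<notin> set ts" using ts True by auto
    have filter: "filter (\<lambda>l. l \<noteq> k) ts = ts"
      using k by (auto intro: filter_True)
    \<comment> \<open>All later times are strictly greater than \<open>k\<close>, so the summation
      variable enters only through the measurement at \<open>k\<close>.\<close>
    have upd: "meas_chain d ket Chan (x(k := y)) k ts B = meas_chain d ket Chan x k ts B" for y B
      by (rule meas_chain_cong) (use k in auto)
    let ?F = "\<lambda>B. mat_trace (meas_chain d ket Chan x k ts B)"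
    have "(\<Sum>y<d. ?F (meas_map d ket y E)) = ?F (mat d d (\<lambda>ij. \<Sum>y<d. meas_map d ket y E $$ ij))"
      by (rule additive_functional_sum[symmetric]) (use trace_meas_chain_add E j True ts in auto)
    also have "\<dots> = ?F E"
      using sum_meas_map[OF onb E] by simp
    also have "\<dots> = mat_trace (meas_chain d ket Chan x i ts A)"
    \<comment> \<open>If \<open>k\<close> is the last time, trace preservation removes the leftover
      evolution; otherwise it merges with the next one.\<close>
    proof (cases ts)
      case Nil
      then show ?thesis using evolve_trace Cons.prems by (simp add: E_def)
    next
      case (Cons l ls)
      then show ?thesis using evolve_trans[of i j l] ts j True by (simp add: E_def)
    qed
    finally show ?thesis using True by (simp add: filter upd[unfolded fun_upd_def] E_def fun_upd_def)
  qed
qed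

text \<open>Deletes the measurements in \<open>S\<close> one by one. Fixing the outcomes outside
  \<open>S\<close> by \<open>z\<close> keeps the summand in the same form when an element is removed
  from \<open>S\<close>.\<close>

lemma sum_PiE_trace_meas_chain:
  assumes onb: "orthonormal_basis d ket" and A: "A \<in> carrier_mat d d"
    and "finite S" "S \<subseteq> set ts" "set ts \<subseteq> {1..N}" "sorted_wrt (<) ts"
  shows "(\<Sum>x\<in>S \<rightarrow>\<^sub>E {..<d}. mat_trace (meas_chain d ket Chan (\<lambda>j. if j \<in> S then x j else z j) 1 ts A))
       = mat_trace (meas_chain d ket Chan z 1 (filter (\<lambda>j. j \<notin> S) ts) A)"
  using assms(3-)
proof (induction S arbitrary: ts)
  case empty
  then show ?case by simp
next
  case (insert a S)
  let ?F = "\<lambda>us x. mat_trace (meas_chain d ket Chan x 1 us A)"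
  let ?ov = "\<lambda>x j. if j \<in> S then x j else z j"
  let ?us = "filter (\<lambda>j. j \<noteq> a) ts"
  have ov: "(\<lambda>j. if j \<in> insert a S then (x(a := y)) j else z j) = (?ov x)(a := y)" for x y
    using insert.hyps(2) by (auto simp: fun_eq_iff)
  have "(\<Sum>x\<in>insert a S \<rightarrow>\<^sub>E {..<d}. ?F ts (\<lambda>j. if j \<in> insert a S then x j else z j))
      = (\<Sum>(y, x)\<in>{..<d} \<times> (S \<rightarrow>\<^sub>E {..<d}). ?F ts ((?ov x)(a := y)))"
    \<comment> \<open>An assignment on \<open>insert a S\<close> corresponds bijectively to its
      value \<open>y\<close> at \<open>a\<close> and an assignment \<open>x\<close> on
      \<open>S\<close>.\<close>
    unfolding PiE_insert_eq
    by (subst sum.reindex[OF inj_combinator[OF insert.hyps(2)]])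
      (simp only: o_def case_prod_unfold ov)
  also have "\<dots> = (\<Sum>x\<in>S \<rightarrow>\<^sub>E {..<d}. \<Sum>y<d. ?F ts ((?ov x)(a := y)))"
    by (simp add: sum.cartesian_product[symmetric] sum.swap[of _ "{..<d}"])
  also have "\<dots> = (\<Sum>x\<in>S \<rightarrow>\<^sub>E {..<d}. ?F ?us (?ov x))"
    by (intro sum.cong refl sum_trace_meas_chain[OF onb A]) (use insert.prems in auto)
  also have "\<dots> = ?F (filter (\<lambda>j. j \<notin> S) ?us) z"
    by (rule insert.IH) (use insert in \<open>auto intro: sorted_wrt_filter\<close>)
  also have "filter (\<lambda>j. j \<notin> S) ?us = filter (\<lambda>j. j \<notin> insert a S) ts"
    by (auto intro: filter_cong)
  finally show ?case .
qed

lemma sum_quasi_prob: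
  assumes onb: "orthonormal_basis d ket" and \<rho>: "\<rho> \<in> carrier_mat d d"
    and N: "2 \<le> N" and k: "k \<in> {1..N}"
  shows "(\<Sum>y<d. quasi_prob d ket Chan \<rho> [1..<Suc N] (x(k := y)))
       = quasi_prob d ket Chan \<rho> (filter (\<lambda>j. j \<noteq> k) [1..<Suc N]) x"
proof -
  \<comment> \<open>Some time survives the deletion of \<open>k\<close>, as N is at least 2;
    \<open>quasi_prob\<close> agrees with a chain from time 1 only for a nonempty list.\<close>
  have "(if k = 1 then 2 else 1) \<in> set (filter (\<lambda>j. j \<noteq> k) [1..<Suc N])"
    using N by auto
  then have "filter (\<lambda>j. j \<noteq> k) [1..<Suc N] \<noteq> []"
    by (metis empty_iff list.set(1))
  moreover have "[1..<Suc N] \<noteq> []" using N by simp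
  moreover have "(\<Sum>y<d. mat_trace (meas_chain d ket Chan (x(k := y)) 1 [1..<Suc N] \<rho>))
       = mat_trace (meas_chain d ket Chan x 1 (filter (\<lambda>j. j \<noteq> k) [1..<Suc N]) \<rho>)"
    by (rule sum_trace_meas_chain[OF onb \<rho>]) (use k in \<open>auto simp del: upt_Suc\<close>)
  ultimately show ?thesis by (simp only: quasi_prob_conv_meas_chain not_False_eq_True)
qed

text \<open>Deleting the measurements at all times but \<open>i\<close> leaves the chain that
  evolves to t_i and measures once.\<close>

lemma marginal_at_eq:
  assumes onb: "orthonormal_basis d ket" and \<rho>: "\<rho> \<in> carrier_mat d d" and i: "i \<in> {1..N}"
  shows "marginal_at d ket Chan \<rho> N i y = mat_trace (state_at Chan \<rho> i * basis_proj d ket y)"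
proof -
  let ?S = "{1..N} - {i}" and ?ts = "[1..<Suc N]"
  (* PiE functions are undefined off their domain, so this choice makes the override by z literally
     equal to x(i := y). *)
  define z where "z = (\<lambda>_. undefined)(i := y)"
  have ts: "?ts \<noteq> []" using i by simp
  have "marginal_at d ket Chan \<rho> N i y
      = (\<Sum>x\<in>?S \<rightarrow>\<^sub>E {..<d}.
          mat_trace (meas_chain d ket Chan (\<lambda>j. if j \<in> ?S then x j else z j) 1 ?ts \<rho>))"
    unfolding marginal_at_def quasi_prob_conv_meas_chain[OF ts]
  proof (rule sum.cong[OF refl])
    fix x assume "x \<in> ?S \<rightarrow>\<^sub>E {..<d}"
    then have "x j = undefined" if "j \<notin> ?S" for j
      using that by (rule PiE_arb)
    then have "x(i := y) = (\<lambda>j. if j \<in> ?S then x j else z j)"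
      by (simp add: z_def fun_eq_iff)
    then show "mat_trace (meas_chain d ket Chan (x(i := y)) 1 ?ts \<rho>)
      = mat_trace (meas_chain d ket Chan (\<lambda>j. if j \<in> ?S then x j else z j) 1 ?ts \<rho>)"
      by simp
  qed
  also have "\<dots> = mat_trace (meas_chain d ket Chan z 1 (filter (\<lambda>j. j \<notin> ?S) ?ts) \<rho>)"
    by (rule sum_PiE_trace_meas_chain[OF onb \<rho>]) (auto simp del: upt_Suc)
  also have "filter (\<lambda>j. j \<notin> ?S) ?ts = filter (\<lambda>j. j = i) ?ts"
    by (rule filter_cong) auto
  also have "\<dots> = [i]"
  proof -
    have "?ts = [1..<i] @ i # [Suc i..<Suc N]"
      using i upt_add_eq_append[of 1 i "Suc N - i"] upt_conv_Cons[of i "Suc N"] by auto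
    then show ?thesis by (simp add: filter_empty_conv del: upt_Suc)
  qed
  finally show ?thesis by (simp add: z_def meas_map_def state_at_def)
qed

end

theorem mainTheorem3:
  fixes d N :: nat
    and ket :: "nat \<Rightarrow> complex vec"
    and \<rho>1 :: "complex mat"
    and Chan :: "nat \<Rightarrow> complex mat \<Rightarrow> complex mat"
  assumes "1 \<le> d"
    and "2 \<le> N"
    and "orthonormal_basis d ket"
    and "density_matrix d \<rho>1"
    and "\<And>i. 1 \<le> i \<Longrightarrow> i \<le> N - 1 \<Longrightarrow> quantum_channel d (Chan i)"
  shows "(\<forall>k\<in>{1..N}. \<forall>x. (\<forall>j\<in>{1..N} - {k}. x j < d) \<longrightarrow>
           (\<Sum>y<d. quasi_prob d ket Chan \<rho>1 [1..<Suc N] (x(k := y)))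
             = quasi_prob d ket Chan \<rho>1 (filter (\<lambda>j. j \<noteq> k) [1..<Suc N]) x)
       \<and> (\<forall>i\<in>{1..N}. \<forall>y<d.
           marginal_at d ket Chan \<rho>1 N i y \<in> \<real> \<and>
           0 \<le> Re (marginal_at d ket Chan \<rho>1 N i y) \<and>
           marginal_at d ket Chan \<rho>1 N i y = mat_trace (state_at Chan \<rho>1 i * basis_proj d ket y))"
proof -
  interpret channel_sequence d N Chan
    by standard (use assms(5) in auto)
  have psd: "pos_semidef d \<rho>1" using assms(4) by (simp add: density_matrix_def)
  then have \<rho>: "\<rho>1 \<in> carrier_mat d d" by (simp add: pos_semidef_def)
  have nonneg: "0 \<le> mat_trace (state_at Chan \<rho>1 i * basis_proj d ket y)"
    if i: "i \<in> {1..N}" and y: "y < d" for i y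
  proof -
    have ket: "ket y \<in> carrier_vec d" by (rule orthonormal_basis_carrier[OF assms(3) y])
    have state: "pos_semidef d (state_at Chan \<rho>1 i)"
      unfolding state_at_def using evolve_pos_semidef[OF psd] i by simp
    then show ?thesis
      using mat_trace_mult_basis_proj[of _ d ket y] ket by (simp add: pos_semidef_def)
  qed
  show ?thesis
  proof (intro conjI ballI allI impI)
    fix k x assume "k \<in> {1..N}"
    then show "(\<Sum>y<d. quasi_prob d ket Chan \<rho>1 [1..<Suc N] (x(k := y)))
             = quasi_prob d ket Chan \<rho>1 (filter (\<lambda>j. j \<noteq> k) [1..<Suc N]) x"
      by (rule sum_quasi_prob[OF assms(3) \<rho> assms(2)])
  next
    fix i y assume i: "i \<in> {1..N}" and y: "y < d"
    show eq: "marginal_at d ket Chan \<rho>1 N i y = mat_trace (state_at Chan \<rho>1 i * basis_proj d ket y)"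
      by (rule marginal_at_eq[OF assms(3) \<rho> i])
    \<comment> \<open>On complex numbers, \<open>0 \<le> z\<close> contains both claims: the
      imaginary part is zero and the real part is non-negative.\<close>
    show "marginal_at d ket Chan \<rho>1 N i y \<in> \<real>" "0 \<le> Re (marginal_at d ket Chan \<rho>1 N i y)"
      using nonneg[OF i y] by (auto simp: eq less_eq_complex_def complex_is_Real_iff)
  qed
qed

end
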